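(* Let $\varphi$ be a strongly convex function satisfying the $\tilde\Delta$-condition, let $\gamma$ be a $\tilde\Delta$-admissible function for $\varphi$, and put $\Phi=\varphi\circ\log$ and $\Psi_\gamma=\varphi\circ\gamma^{-1}\circ\log$. Then $$\operatorname{Alg}(\mathcal H_{\Psi_\gamma})\subset \operatorname{Mult}(\mathcal H_\Phi).$$
   Context: $\mathbb D$ is the open unit disk, $\mathbb T=\partial\mathbb D$ with normalized Lebesgue measure $m$, $\operatorname{Hol}(\mathbb D)$ is the space of holomorphic functions on $\mathbb D$, and $N^+$ is the Smirnov class on $\mathbb D$; functions in $N^+$ have non-tangential boundary values a.e. on $\mathbb T$, denoted by the same letter. A function $\varphi:\mathbb R\to[0,\infty)$ is strongly convex if it is convex, nondecreasing and $\lim_{t\to\infty}\varphi(t)/t=\infty$; one sets $\varphi(-\infty)=0$. For a nondecreasing $\Phi:[0,\infty)\to[0,\infty)$, the Hardy-Orlicz class is $\mathcal H_\Phi=\{f\in N^+:\int_{\mathbb T}\Phi(|f|)\,dm<\infty\}$. For $X\subset\operatorname{Hol}(\mathbb D)$, $\operatorname{Mult}(X)=\{g\in\operatorname{Hol}(\mathbb D): gf\in X \text{ for all } f\in X\}$, and $\operatorname{Alg}(X)$ is the algebra of functions generated by $X$. A convex, strictly increasing $\varphi:\mathbb R\to\mathbb R^+$ with $\varphi(t)/t\to\infty$ as $t\to\infty$ satisfies the $\tilde\Delta$-condition if there are $c>1$, $t_0\ge 0$ and a strictly increasing concave function $\gamma:\mathbb R^+\to\mathbb R^+$ with $\lim_{t\to\infty}\gamma(t)=\infty$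 such that $\varphi(t+\gamma(t))/\varphi(t)\le c$ for all $t\ge t_0$. Any such $\gamma$ (for suitable $c,t_0$) is called $\tilde\Delta$-admissible for $\varphi$. Convention: $\gamma^{-1}(u):=0$ for $u\le \inf_{s>0}\gamma(s)$ (including $u=-\infty$); the values of $\Psi_\gamma(t)$ for small $t$ do not affect the class $\mathcal H_{\Psi_\gamma}$. *)

theory Defs
  imports "HOL-Analysis.Analysis"
begin

text \<open>Functions on the open unit disk are represented by total functions of type
  \<^typ>\<open>complex \<Rightarrow> complex\<close>; none of the classes below depends on values outside the disk.\<close>

abbreviation unit_disk :: "complex set" where
  "unit_disk \<equiv> ball 0 1"

abbreviation unit_circle :: "complex set" where
  "unit_circle \<equiv> sphere 0 1"

definition Hol :: "(complex \<Rightarrow> complex) set" where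
  "Hol = {f. f holomorphic_on unit_disk}"

definition circle_measure :: "complex measure" where
  "circle_measure =
     distr (uniform_measure lborel {0..2 * pi}) (restrict_space borel unit_circle) cis"

definition bounded_holomorphic :: "(complex \<Rightarrow> complex) \<Rightarrow> bool" where
  "bounded_holomorphic f \<longleftrightarrow> f \<in> Hol \<and> bounded (f ` unit_disk)"

definition outer_function :: "(complex \<Rightarrow> complex) \<Rightarrow> bool" where
  "outer_function h \<longleftrightarrow>
     (\<exists>c k. cmod c = 1 \<and> k \<in> borel_measurable circle_measure \<and>
        (AE \<zeta> in circle_measure. 0 < k \<zeta>) \<and>
        integrable circle_measure (\<lambda>\<zeta>. ln (k \<zeta>)) \<and>
        (\<forall>z\<in>unit_disk.
           h z = c * exp (LINT \<zeta>|circle_measure. (\<zeta> + z) / (\<zeta> - z) * complex_of_real (ln (k \<zeta>)))))"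

text \<open>The Smirnov class as the quotients of bounded holomorphic functions with outer
  denominator. An outer function has no zeros in the disk.\<close>

definition smirnov_class :: "(complex \<Rightarrow> complex) set" where
  "smirnov_class =
     {f. \<exists>g h. bounded_holomorphic g \<and> bounded_holomorphic h \<and> outer_function h \<and>
           (\<forall>z\<in>unit_disk. f z = g z / h z)}"

definition stolz_region :: "real \<Rightarrow> complex \<Rightarrow> complex set" where
  "stolz_region \<alpha> \<zeta> = {z \<in> unit_disk. cmod (\<zeta> - z) < \<alpha> * (1 - cmod z)}"

definition nontangential_limit :: "(complex \<Rightarrow> complex) \<Rightarrow> complex \<Rightarrow> complex \<Rightarrow> bool" where
  "nontangential_limit f \<zeta> l \<longleftrightarrow> (\<forall>\<alpha>>1. (f \<longlongrightarrow> l) (at \<zeta> within stolz_region \<alpha> \<zeta>))"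

definition boundary_function :: "(complex \<Rightarrow> complex) \<Rightarrow> (complex \<Rightarrow> complex) \<Rightarrow> bool" where
  "boundary_function f F \<longleftrightarrow>
     F \<in> borel_measurable circle_measure \<and>
     (AE \<zeta> in circle_measure. nontangential_limit f \<zeta> (F \<zeta>))"

text \<open>Every function in the Smirnov class has a boundary function (Fatou), and two boundary
  functions of the same function agree almost everywhere. Hence the existential quantifier
  below only names the boundary function of \<open>f\<close>; it puts no further condition on \<open>f\<close>.\<close>

definition hardy_orlicz :: "(real \<Rightarrow> real) \<Rightarrow> (complex \<Rightarrow> complex) set" where
  "hardy_orlicz \<Phi> =
     {f \<in> smirnov_class.
        \<exists>F. boundary_function f F \<and>
            (\<integral>\<^sup>+ \<zeta>. ennreal (\<Phi> (cmod (F \<zeta>))) \<partial>circle_measure) < \<infinity>}"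

definition Mult :: "(complex \<Rightarrow> complex) set \<Rightarrow> (complex \<Rightarrow> complex) set" where
  "Mult X = {g \<in> Hol. \<forall>f\<in>X. (\<lambda>z. g z * f z) \<in> X}"

definition function_algebra :: "(complex \<Rightarrow> complex) set \<Rightarrow> bool" where
  "function_algebra A \<longleftrightarrow>
     (\<lambda>z. 0) \<in> A \<and>
     (\<forall>f\<in>A. \<forall>g\<in>A. (\<lambda>z. f z + g z) \<in> A) \<and>
     (\<forall>c. \<forall>f\<in>A. (\<lambda>z. c * f z) \<in> A) \<and>
     (\<forall>f\<in>A. \<forall>g\<in>A. (\<lambda>z. f z * g z) \<in> A)"

text \<open>No unit is adjoined. For the classes \<^term>\<open>hardy_orlicz \<Phi>\<close> this makes no difference,
  because they contain the constant functions.\<close>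

definition Alg :: "(complex \<Rightarrow> complex) set \<Rightarrow> (complex \<Rightarrow> complex) set" where
  "Alg X = function_algebra hull X"

definition strongly_convex :: "(real \<Rightarrow> real) \<Rightarrow> bool" where
  "strongly_convex \<phi> \<longleftrightarrow>
     (\<forall>t. 0 \<le> \<phi> t) \<and> convex_on UNIV \<phi> \<and> mono \<phi> \<and> filterlim (\<lambda>t. \<phi> t / t) at_top at_top"

text \<open>Only the restriction of \<open>\<gamma>\<close> to \<open>[0, \<infinity>)\<close> matters; there \<open>\<gamma>\<close> may jump at \<open>0\<close>.\<close>

definition tilde_Delta_admissible :: "(real \<Rightarrow> real) \<Rightarrow> (real \<Rightarrow> real) \<Rightarrow> bool" where
  "tilde_Delta_admissible \<phi> \<gamma> \<longleftrightarrow>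
     (\<forall>t\<ge>0. 0 \<le> \<gamma> t) \<and> strict_mono_on {0..} \<gamma> \<and> concave_on {0..} \<gamma> \<and>
     filterlim \<gamma> at_top at_top \<and>
     (\<exists>c>1. \<exists>t0\<ge>0. \<forall>t\<ge>t0. \<phi> (t + \<gamma> t) / \<phi> t \<le> c)"

definition tilde_Delta :: "(real \<Rightarrow> real) \<Rightarrow> bool" where
  "tilde_Delta \<phi> \<longleftrightarrow>
     (\<forall>t. 0 \<le> \<phi> t) \<and> convex_on UNIV \<phi> \<and> strict_mono \<phi> \<and>
     filterlim (\<lambda>t. \<phi> t / t) at_top at_top \<and> (\<exists>\<gamma>. tilde_Delta_admissible \<phi> \<gamma>)"

text \<open>The logarithm on \<open>[0, \<infinity>)\<close> with \<open>log 0 = -\<infinity>\<close>. It is never applied to a negative number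
  and never takes the value \<open>\<infinity>\<close>.\<close>

definition log_ext :: "real \<Rightarrow> ereal" where
  "log_ext x = (if x = 0 then -\<infinity> else ereal (ln x))"

definition extend_by_zero :: "(real \<Rightarrow> real) \<Rightarrow> ereal \<Rightarrow> real" where
  "extend_by_zero \<phi> u = (if u = -\<infinity> then 0 else \<phi> (real_of_ereal u))"

definition gamma_inv :: "(real \<Rightarrow> real) \<Rightarrow> ereal \<Rightarrow> real" where
  "gamma_inv \<gamma> u =
     (if u \<le> ereal (INF s\<in>{0<..}. \<gamma> s) then 0 else (THE s. 0 < s \<and> ereal (\<gamma> s) = u))"

definition Phi_of :: "(real \<Rightarrow> real) \<Rightarrow> real \<Rightarrow> real" where
  "Phi_of \<phi> = extend_by_zero \<phi> \<circ> log_ext"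

definition Psi_of :: "(real \<Rightarrow> real) \<Rightarrow> (real \<Rightarrow> real) \<Rightarrow> real \<Rightarrow> real" where
  "Psi_of \<phi> \<gamma> = \<phi> \<circ> gamma_inv \<gamma> \<circ> log_ext"

end

theory Submission
  imports Defs
begin

text \<open>Everything rests on the pointwise inequality
  \<open>\<Phi> (x y) \<le> c (\<Phi> x + \<Psi>\<^sub>\<gamma> y + \<phi> T)\<close>: with \<open>t = log x\<close>, \<open>u = log y\<close> and
  \<open>r = max T (max t (\<gamma>\<^sup>-\<^sup>1 u))\<close> one has \<open>t + u \<le> r + \<gamma> r\<close>, so the \<open>\<Delta>\<close>-condition applies at \<open>r\<close>.
  Integrating it over the circle shows that \<open>\<H>\<^sub>\<Psi>\<close> multiplies \<open>\<H>\<^sub>\<Phi>\<close> into itself, and, for constant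
  \<open>y = 2\<close>, that \<open>\<H>\<^sub>\<Phi>\<close> is a vector space. Hence \<open>Mult \<H>\<^sub>\<Phi>\<close> is an algebra containing \<open>\<H>\<^sub>\<Psi>\<close>.\<close>

section \<open>The circle measure and the Smirnov class\<close>

lemma space_circle_measure: "space circle_measure = unit_circle"
  by (simp add: circle_measure_def space_restrict_space)

lemma sets_circle_measure [measurable_cong]:
  "sets circle_measure = sets (restrict_space borel unit_circle)"
  by (simp add: circle_measure_def)

lemma measurable_id_circle_measure [measurable]: "(\<lambda>\<zeta>. \<zeta>) \<in> borel_measurable circle_measure"
  unfolding measurable_cong_sets[OF sets_circle_measure refl] by (intro measurable_restrict_space1) simp

text \<open>The arc \<open>{0..2 * pi}\<close> has positive finite length, so normalizing it gives a
  finite measure, and \<open>cis\<close> pushes it forward. Finiteness is what makes additive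
  constants harmless in the integral estimates.\<close>

lemma finite_measure_circle_measure: "finite_measure circle_measure"
proof -
  have "finite_measure (uniform_measure lborel {0..2 * pi})"
    by (rule finite_measureI) (simp add: emeasure_uniform_measure)
  moreover have "cis \<in> borel_measurable borel"
    by (intro borel_measurable_continuous_onI continuous_intros)
  hence "cis \<in> uniform_measure lborel {0..2 * pi} \<rightarrow>\<^sub>M restrict_space borel unit_circle"
    by (intro measurable_restrict_space2) auto
  ultimately show ?thesis
    unfolding circle_measure_def by (rule finite_measure.finite_measure_distr)
qed

section \<open>Bounded holomorphic functions on the disk\<close>

lemma bounded_holomorphic_add:
  assumes "bounded_holomorphic f" "bounded_holomorphic g"
  shows "bounded_holomorphic (\<lambda>z. f z + g z)"
  using assms unfolding bounded_holomorphic_def Hol_def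
  by (auto intro: holomorphic_intros bounded_plus_comp)

lemma bounded_holomorphic_mult:
  assumes "bounded_holomorphic f" "bounded_holomorphic g"
  shows "bounded_holomorphic (\<lambda>z. f z * g z)"
proof -
  obtain A B where A: "\<And>z. z \<in> unit_disk \<Longrightarrow> cmod (f z) \<le> A"
      and B: "\<And>z. z \<in> unit_disk \<Longrightarrow> cmod (g z) \<le> B"
    using assms unfolding bounded_holomorphic_def bounded_iff by blast
  have "cmod (f z * g z) \<le> A * B" if "z \<in> unit_disk" for z
    unfolding norm_mult using A[OF that] B[OF that]
    by (intro mult_mono) (auto intro: order_trans[OF norm_ge_zero])
  hence "bounded ((\<lambda>z. f z * g z) ` unit_disk)"
    unfolding bounded_iff by blast
  thus ?thesis
    using assms unfolding bounded_holomorphic_def Hol_def by (auto intro: holomorphic_intros)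
qed

lemma bounded_holomorphic_const: "bounded_holomorphic (\<lambda>z. c)"
  unfolding bounded_holomorphic_def Hol_def
  by (auto simp: bounded_iff)

section \<open>Herglotz integrals and outer functions\<close>

text \<open>For fixed \<open>z\<close> in the disk the kernel is bounded on the circle by
  \<open>2 / (1 - cmod z)\<close>, so the integrand is dominated by a multiple of \<open>u\<close>.
  This allows the integral of a sum of logarithms to be split.\<close>

lemma integrable_Herglotz:
  fixes u :: "complex \<Rightarrow> real"
  assumes u: "integrable circle_measure u" and z: "z \<in> unit_disk"
  shows "integrable circle_measure (\<lambda>\<zeta>. (\<zeta> + z) / (\<zeta> - z) * complex_of_real (u \<zeta>))"
proof (rule Bochner_Integration.integrable_bound)
  show "integrable circle_measure (\<lambda>\<zeta>. 2 / (1 - cmod z) * u \<zeta>)"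
    using u by simp
  have [measurable]: "u \<in> borel_measurable circle_measure"
    using u by (rule borel_measurable_integrable)
  show "(\<lambda>\<zeta>. (\<zeta> + z) / (\<zeta> - z) * complex_of_real (u \<zeta>)) \<in> borel_measurable circle_measure"
    by measurable
  show "AE \<zeta> in circle_measure. norm ((\<zeta> + z) / (\<zeta> - z) * complex_of_real (u \<zeta>))
      \<le> norm (2 / (1 - cmod z) * u \<zeta>)"
  proof (rule AE_I2)
    fix \<zeta> assume "\<zeta> \<in> space circle_measure"
    hence \<zeta>: "cmod \<zeta> = 1"
      by (simp add: space_circle_measure)
    have z1: "cmod z < 1"
      using z by simp
    have "cmod (\<zeta> + z) \<le> 2"
      using norm_triangle_ineq[of \<zeta> z] \<zeta> z1 by linarith
    moreover have "1 - cmod z \<le> cmod (\<zeta> - z)"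
      using norm_triangle_ineq2[of \<zeta> z] \<zeta> by simp
    ultimately have "cmod (\<zeta> + z) / cmod (\<zeta> - z) \<le> 2 / (1 - cmod z)"
      using z1 by (intro frac_le) auto
    hence "cmod (\<zeta> + z) / cmod (\<zeta> - z) * \<bar>u \<zeta>\<bar> \<le> 2 / (1 - cmod z) * \<bar>u \<zeta>\<bar>"
      by (rule mult_right_mono) simp
    thus "norm ((\<zeta> + z) / (\<zeta> - z) * complex_of_real (u \<zeta>)) \<le> norm (2 / (1 - cmod z) * u \<zeta>)"
      using z1 by (simp add: norm_mult norm_divide abs_mult)
  qed
qed

text \<open>A unimodular constant times an exponential cannot vanish.\<close>

lemma outer_function_nonzero:
  assumes "outer_function h" "z \<in> unit_disk"
  shows "h z \<noteq> 0"
  using assms unfolding outer_function_def by fastforce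

lemma outer_function_one: "outer_function (\<lambda>z. 1)"
  unfolding outer_function_def by (intro exI[of _ 1] exI[of _ "\<lambda>_. 1"]) simp

text \<open>Logarithms add and exponentials multiply, so the product is outer with constant
  \<open>c1 * c2\<close> and boundary weight \<open>k1 * k2\<close>.\<close>

lemma outer_function_mult:
  assumes "outer_function h1" "outer_function h2"
  shows "outer_function (\<lambda>z. h1 z * h2 z)"
proof -
  obtain c1 k1 where 1: "cmod c1 = 1" "k1 \<in> borel_measurable circle_measure"
      "AE \<zeta> in circle_measure. 0 < k1 \<zeta>" "integrable circle_measure (\<lambda>\<zeta>. ln (k1 \<zeta>))"
      "\<And>z. z \<in> unit_disk \<Longrightarrow>
        h1 z = c1 * exp (LINT \<zeta>|circle_measure. (\<zeta> + z) / (\<zeta> - z) * complex_of_real (ln (k1 \<zeta>)))"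
    using assms(1) unfolding outer_function_def by blast
  obtain c2 k2 where 2: "cmod c2 = 1" "k2 \<in> borel_measurable circle_measure"
      "AE \<zeta> in circle_measure. 0 < k2 \<zeta>" "integrable circle_measure (\<lambda>\<zeta>. ln (k2 \<zeta>))"
      "\<And>z. z \<in> unit_disk \<Longrightarrow>
        h2 z = c2 * exp (LINT \<zeta>|circle_measure. (\<zeta> + z) / (\<zeta> - z) * complex_of_real (ln (k2 \<zeta>)))"
    using assms(2) unfolding outer_function_def by blast
  note [measurable] = 1(2) 2(2)
  \<comment> \<open>The logarithm is split where both weights are positive, hence only almost
    everywhere; the integrals below are therefore compared by their AE congruence rules.\<close>
  have ln: "AE \<zeta> in circle_measure. ln (k1 \<zeta> * k2 \<zeta>) = ln (k1 \<zeta>) + ln (k2 \<zeta>)"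
    using 1(3) 2(3) by eventually_elim (simp add: ln_mult)
  have "integrable circle_measure (\<lambda>\<zeta>. ln (k1 \<zeta>) + ln (k2 \<zeta>))"
    using 1(4) 2(4) by simp
  hence int: "integrable circle_measure (\<lambda>\<zeta>. ln (k1 \<zeta> * k2 \<zeta>))"
    by (rule integrable_cong_AE_imp) (use ln in auto)
  have "h1 z * h2 z = (c1 * c2) *
      exp (LINT \<zeta>|circle_measure. (\<zeta> + z) / (\<zeta> - z) * complex_of_real (ln (k1 \<zeta> * k2 \<zeta>)))"
    if z: "z \<in> unit_disk" for z
  proof -
    have "(LINT \<zeta>|circle_measure. (\<zeta> + z) / (\<zeta> - z) * complex_of_real (ln (k1 \<zeta> * k2 \<zeta>)))
        = (LINT \<zeta>|circle_measure. (\<zeta> + z) / (\<zeta> - z) * complex_of_real (ln (k1 \<zeta>))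
            + (\<zeta> + z) / (\<zeta> - z) * complex_of_real (ln (k2 \<zeta>)))"
    proof (rule integral_cong_AE)
      show "AE \<zeta> in circle_measure. (\<zeta> + z) / (\<zeta> - z) * complex_of_real (ln (k1 \<zeta> * k2 \<zeta>))
          = (\<zeta> + z) / (\<zeta> - z) * complex_of_real (ln (k1 \<zeta>))
            + (\<zeta> + z) / (\<zeta> - z) * complex_of_real (ln (k2 \<zeta>))"
        using ln by eventually_elim (simp only: of_real_add distrib_left)
    qed measurable
    also have "\<dots> = (LINT \<zeta>|circle_measure. (\<zeta> + z) / (\<zeta> - z) * complex_of_real (ln (k1 \<zeta>)))
        + (LINT \<zeta>|circle_measure. (\<zeta> + z) / (\<zeta> - z) * complex_of_real (ln (k2 \<zeta>)))"
      by (intro Bochner_Integration.integral_add integrable_Herglotz 1(4) 2(4) z)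
    finally show ?thesis
      using 1(5)[OF z] 2(5)[OF z] by (simp only: exp_add mult_ac)
  qed
  moreover have "AE \<zeta> in circle_measure. 0 < k1 \<zeta> * k2 \<zeta>"
    using 1(3) 2(3) by eventually_elim simp
  ultimately show ?thesis
    using int 1(1) 2(1) unfolding outer_function_def
    by (intro exI[of _ "c1 * c2"] exI[of _ "\<lambda>\<zeta>. k1 \<zeta> * k2 \<zeta>"]) (auto simp: norm_mult)
qed

section \<open>Algebraic closure of the Smirnov class\<close>

lemma smirnov_class_add:
  assumes "f1 \<in> smirnov_class" "f2 \<in> smirnov_class"
  shows "(\<lambda>z. f1 z + f2 z) \<in> smirnov_class"
proof -
  obtain g1 h1 g2 h2 where *:
      "bounded_holomorphic g1" "bounded_holomorphic h1" "outer_function h1"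
      "\<And>z. z \<in> unit_disk \<Longrightarrow> f1 z = g1 z / h1 z"
      "bounded_holomorphic g2" "bounded_holomorphic h2" "outer_function h2"
      "\<And>z. z \<in> unit_disk \<Longrightarrow> f2 z = g2 z / h2 z"
    using assms unfolding smirnov_class_def by auto
  \<comment> \<open>The common denominator \<open>h1 * h2\<close> is again bounded and
    outer.\<close>
  have "f1 z + f2 z = (g1 z * h2 z + g2 z * h1 z) / (h1 z * h2 z)" if "z \<in> unit_disk" for z
    using *(4,8)[OF that] *(3,7)[THEN outer_function_nonzero, OF that] by (simp add: add_frac_eq)
  moreover have "bounded_holomorphic (\<lambda>z. g1 z * h2 z + g2 z * h1 z)"
    by (intro bounded_holomorphic_add bounded_holomorphic_mult *)
  moreover have "bounded_holomorphic (\<lambda>z. h1 z * h2 z)"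
    by (intro bounded_holomorphic_mult *)
  moreover have "outer_function (\<lambda>z. h1 z * h2 z)"
    by (intro outer_function_mult *)
  ultimately show ?thesis
    unfolding smirnov_class_def by blast
qed

lemma smirnov_class_mult:
  assumes "f1 \<in> smirnov_class" "f2 \<in> smirnov_class"
  shows "(\<lambda>z. f1 z * f2 z) \<in> smirnov_class"
proof -
  obtain g1 h1 g2 h2 where *:
      "bounded_holomorphic g1" "bounded_holomorphic h1" "outer_function h1"
      "\<And>z. z \<in> unit_disk \<Longrightarrow> f1 z = g1 z / h1 z"
      "bounded_holomorphic g2" "bounded_holomorphic h2" "outer_function h2"
      "\<And>z. z \<in> unit_disk \<Longrightarrow> f2 z = g2 z / h2 z"
    using assms unfolding smirnov_class_def by auto
  have "f1 z * f2 z = (g1 z * g2 z) / (h1 z * h2 z)" if "z \<in> unit_disk" for z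
    using *(4,8)[OF that] by simp
  moreover have "bounded_holomorphic (\<lambda>z. g1 z * g2 z)" "bounded_holomorphic (\<lambda>z. h1 z * h2 z)"
    by (intro bounded_holomorphic_mult *)+
  moreover have "outer_function (\<lambda>z. h1 z * h2 z)"
    by (intro outer_function_mult *)
  ultimately show ?thesis
    unfolding smirnov_class_def by blast
qed

lemma smirnov_class_const: "(\<lambda>z. c) \<in> smirnov_class"
proof -
  have "bounded_holomorphic (\<lambda>z. c)" "bounded_holomorphic (\<lambda>z. 1)"
    by (rule bounded_holomorphic_const)+
  with outer_function_one show ?thesis
    unfolding smirnov_class_def by (intro CollectI exI[of _ "\<lambda>z. c"] exI[of _ "\<lambda>z. 1"]) simp
qed

lemma smirnov_class_subset_Hol: "smirnov_class \<subseteq> Hol"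
proof
  fix f assume "f \<in> smirnov_class"
  then obtain g h where gh: "bounded_holomorphic g" "bounded_holomorphic h" "outer_function h"
      "\<And>z. z \<in> unit_disk \<Longrightarrow> f z = g z / h z"
    unfolding smirnov_class_def by blast
  have "(\<lambda>z. g z / h z) holomorphic_on unit_disk"
    using gh outer_function_nonzero unfolding bounded_holomorphic_def Hol_def
    by (auto intro!: holomorphic_intros)
  thus "f \<in> Hol"
    unfolding Hol_def using gh(4) holomorphic_transform[of _ unit_disk f] by simp
qed

section \<open>Boundary functions and domination on the circle\<close>

lemma boundary_function_add:
  assumes "boundary_function f F" "boundary_function g G"
  shows "boundary_function (\<lambda>z. f z + g z) (\<lambda>\<zeta>. F \<zeta> + G \<zeta>)"
proof -
  have "AE \<zeta> in circle_measure. nontangential_limit f \<zeta> (F \<zeta>)"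
       "AE \<zeta> in circle_measure. nontangential_limit g \<zeta> (G \<zeta>)"
    using assms unfolding boundary_function_def by auto
  hence "AE \<zeta> in circle_measure. nontangential_limit (\<lambda>z. f z + g z) \<zeta> (F \<zeta> + G \<zeta>)"
    by eventually_elim (auto simp: nontangential_limit_def intro: tendsto_add)
  thus ?thesis
    using assms unfolding boundary_function_def by auto
qed

lemma boundary_function_mult:
  assumes "boundary_function f F" "boundary_function g G"
  shows "boundary_function (\<lambda>z. f z * g z) (\<lambda>\<zeta>. F \<zeta> * G \<zeta>)"
proof -
  have "AE \<zeta> in circle_measure. nontangential_limit f \<zeta> (F \<zeta>)"
       "AE \<zeta> in circle_measure. nontangential_limit g \<zeta> (G \<zeta>)"
    using assms unfolding boundary_function_def by auto
  hence "AE \<zeta> in circle_measure. nontangential_limit (\<lambda>z. f z * g z) \<zeta> (F \<zeta> * G \<zeta>)"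
    by eventually_elim (auto simp: nontangential_limit_def intro: tendsto_mult)
  thus ?thesis
    using assms unfolding boundary_function_def by auto
qed

lemma boundary_function_const: "boundary_function (\<lambda>z. c) (\<lambda>\<zeta>. c)"
  unfolding boundary_function_def nontangential_limit_def by simp

text \<open>The constant \<open>K\<close> has finite integral because the measure is finite. This
  converts a pointwise inequality between boundary values into membership in
  \<open>hardy_orlicz\<close>.\<close>

lemma nn_integral_circle_measure_dominated:
  fixes p q :: "complex \<Rightarrow> real"
  assumes [measurable]: "p \<in> borel_measurable circle_measure" "q \<in> borel_measurable circle_measure"
    and nonneg: "\<And>\<zeta>. 0 \<le> p \<zeta>" "\<And>\<zeta>. 0 \<le> q \<zeta>" "0 \<le> c" "0 \<le> K"
    and le: "\<And>\<zeta>. r \<zeta> \<le> c * (p \<zeta> + q \<zeta> + K)"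
    and fin: "(\<integral>\<^sup>+ \<zeta>. ennreal (p \<zeta>) \<partial>circle_measure) < \<infinity>"
             "(\<integral>\<^sup>+ \<zeta>. ennreal (q \<zeta>) \<partial>circle_measure) < \<infinity>"
  shows "(\<integral>\<^sup>+ \<zeta>. ennreal (r \<zeta>) \<partial>circle_measure) < \<infinity>"
proof -
  have "(\<integral>\<^sup>+ \<zeta>. ennreal (r \<zeta>) \<partial>circle_measure)
      \<le> (\<integral>\<^sup>+ \<zeta>. ennreal c * (ennreal (p \<zeta>) + ennreal (q \<zeta>) + ennreal K) \<partial>circle_measure)"
  proof (rule nn_integral_mono)
    fix \<zeta>
    have "ennreal (r \<zeta>) \<le> ennreal (c * (p \<zeta> + q \<zeta> + K))"
      using le by (rule ennreal_leI)
    thus "ennreal (r \<zeta>) \<le> ennreal c * (ennreal (p \<zeta>) + ennreal (q \<zeta>) + ennreal K)"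
      using nonneg by (simp add: ennreal_mult)
  qed
  also have "\<dots> = ennreal c * ((\<integral>\<^sup>+ \<zeta>. ennreal (p \<zeta>) \<partial>circle_measure)
      + (\<integral>\<^sup>+ \<zeta>. ennreal (q \<zeta>) \<partial>circle_measure) + ennreal K * emeasure circle_measure unit_circle)"
    by (simp add: nn_integral_cmult nn_integral_add space_circle_measure)
  also have "\<dots> < \<infinity>"
    using fin finite_measure.emeasure_finite[OF finite_measure_circle_measure, of unit_circle]
    by (simp add: ennreal_mult_less_top less_top[symmetric] ennreal_mult_eq_top_iff)
  finally show ?thesis .
qed

section \<open>The functions \<open>\<Phi>\<close> and \<open>\<Psi>\<^sub>\<gamma>\<close>\<close>

lemma Phi_of_eq: "Phi_of \<phi> x = (if x = 0 then 0 else \<phi> (ln x))"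
  by (simp add: Phi_of_def extend_by_zero_def log_ext_def)

section \<open>The generalized inverse of \<open>\<gamma>\<close>\<close>

lemma gamma_inv_eq:
  assumes mono: "strict_mono_on {0..} \<gamma>" and s: "0 < s" and nonneg: "\<And>t. 0 \<le> t \<Longrightarrow> 0 \<le> \<gamma> t"
  shows "gamma_inv \<gamma> (ereal (\<gamma> s)) = s"
proof -
  have "bdd_below (\<gamma> ` {0<..})"
    by (rule bdd_belowI2[of _ 0]) (simp add: nonneg)
  \<comment> \<open>Passing through \<open>s / 2\<close> makes the infimum strictly smaller than
    \<open>\<gamma> s\<close>, so the definite description is the branch that applies; injectivity
    of \<open>\<gamma>\<close> then identifies its value.\<close>
  hence "(INF s\<in>{0<..}. \<gamma> s) \<le> \<gamma> (s / 2)"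
    using s by (intro cINF_lower) auto
  also have "\<gamma> (s / 2) < \<gamma> s"
    using s by (intro strict_mono_onD[OF mono]) auto
  finally have "\<not> ereal (\<gamma> s) \<le> ereal (INF s\<in>{0<..}. \<gamma> s)"
    by simp
  moreover have "(THE s'. 0 < s' \<and> ereal (\<gamma> s') = ereal (\<gamma> s)) = s"
    using s strict_mono_on_imp_inj_on[OF mono] by (intro the_equality) (auto dest: inj_onD)
  ultimately show ?thesis
    by (simp add: gamma_inv_def)
qed

locale admissible =
  fixes \<phi> \<gamma> :: "real \<Rightarrow> real"
  assumes \<phi>_nonneg: "0 \<le> \<phi> t"
    and \<phi>_mono: "strict_mono \<phi>"
    and admissible: "tilde_Delta_admissible \<phi> \<gamma>"
begin

lemma \<phi>_le: "s \<le> t \<Longrightarrow> \<phi> s \<le> \<phi> t"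
  using strict_mono_mono[OF \<phi>_mono] by (rule monoD)

lemma \<gamma>_nonneg: "0 \<le> t \<Longrightarrow> 0 \<le> \<gamma> t"
  and \<gamma>_mono: "strict_mono_on {0..} \<gamma>"
  and \<gamma>_concave: "concave_on {0..} \<gamma>"
  and \<gamma>_at_top: "filterlim \<gamma> at_top at_top"
  using admissible unfolding tilde_Delta_admissible_def by auto

lemma \<gamma>_le: "0 \<le> s \<Longrightarrow> s \<le> t \<Longrightarrow> \<gamma> s \<le> \<gamma> t"
  using strict_mono_on_leD[OF \<gamma>_mono] by simp

lemma INF_\<gamma>_le: "0 < s \<Longrightarrow> (INF s\<in>{0<..}. \<gamma> s) \<le> \<gamma> s"
  by (intro cINF_lower bdd_belowI2[of _ 0]) (simp_all add: \<gamma>_nonneg)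

text \<open>Intermediate value theorem between a point \<open>a > 0\<close> where
  \<open>\<gamma>\<close> is below \<open>u\<close> and a point \<open>b\<close> where it has
  reached \<open>u\<close>, the latter because \<open>\<gamma>\<close> tends to infinity.\<close>

lemma \<gamma>_surj:
  assumes "(INF s\<in>{0<..}. \<gamma> s) < u"
  obtains s where "0 < s" "\<gamma> s = u"
proof -
  have "\<exists>a\<in>{0<..}. \<gamma> a < u"
  proof (rule ccontr)
    assume "\<not> ?thesis"
    hence "u \<le> (INF s\<in>{0<..}. \<gamma> s)"
      by (intro cINF_greatest) (auto simp: not_less)
    thus False
      using assms by simp
  qed
  then obtain a where a: "0 < a" "\<gamma> a < u"
    by auto
  have "eventually (\<lambda>b. u \<le> \<gamma> b \<and> a \<le> b) at_top"
    using \<gamma>_at_top unfolding filterlim_at_top by (intro eventually_conj eventually_ge_at_top) auto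
  then obtain b where b: "u \<le> \<gamma> b" "a \<le> b"
    using eventually_happens by fastforce
  \<comment> \<open>Convexity yields continuity on open sets; the origin is excluded because
    \<open>\<gamma>\<close> may jump there.\<close>
  have "convex_on {0<..} (\<lambda>s. - \<gamma> s)"
    using \<gamma>_concave unfolding concave_on_def by (rule convex_on_subset) (auto simp: convex_real_interval)
  hence "continuous_on {0<..} (\<lambda>s. - \<gamma> s)"
    by (intro convex_on_continuous) auto
  hence "continuous_on {0<..} \<gamma>"
    using continuous_on_minus by fastforce
  hence "continuous_on {a..b} \<gamma>"
    by (rule continuous_on_subset) (use a in auto)
  then obtain s where "a \<le> s" "\<gamma> s = u"
    using IVT'[of \<gamma> a u b] a b by auto
  with a show ?thesis
    by (intro that[of s]) auto
qed

text \<open>Replaces the definite description by a witness \<open>s\<close>, which exists by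
  \<open>\<gamma>_surj\<close>. At \<open>\<infinity>\<close> no such witness exists, so this value
  is split off; \<open>log_ext\<close> never attains it.\<close>

lemma gamma_inv_cases:
  obtains (low) "u \<le> ereal (INF s\<in>{0<..}. \<gamma> s)" "gamma_inv \<gamma> u = 0"
    | (high) s where "0 < s" "u = ereal (\<gamma> s)" "gamma_inv \<gamma> u = s"
    | (top) "u = \<infinity>"
proof (cases "u \<le> ereal (INF s\<in>{0<..}. \<gamma> s)")
  case True
  thus ?thesis
    using low by (simp add: gamma_inv_def)
next
  case False
  show ?thesis
  proof (cases u)
    case (real r)
    with False obtain s where "0 < s" "\<gamma> s = r"
      using \<gamma>_surj[of r] by auto
    thus ?thesis
      using high[of s] gamma_inv_eq[OF \<gamma>_mono, of s] \<gamma>_nonneg real by auto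
  qed (use False top in auto)
qed

lemma gamma_inv_nonneg: "u \<noteq> \<infinity> \<Longrightarrow> 0 \<le> gamma_inv \<gamma> u"
  by (cases u rule: gamma_inv_cases) auto

lemma gamma_inv_mono:
  assumes "u \<le> v" "v \<noteq> \<infinity>"
  shows "gamma_inv \<gamma> u \<le> gamma_inv \<gamma> v"
proof (cases u rule: gamma_inv_cases)
  case low
  thus ?thesis
    using gamma_inv_nonneg[OF assms(2)] by simp
next
  case (high s)
  show ?thesis
  proof (cases v rule: gamma_inv_cases)
    case low
    \<comment> \<open>This case is contradictory: \<open>v\<close> lies below the infimum, hence
      below \<open>\<gamma> (s / 2)\<close>, while \<open>u = \<gamma> s\<close> is at most
      \<open>v\<close>.\<close>
    have "\<gamma> s \<le> \<gamma> (s / 2)"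
      using assms(1) high low(1) INF_\<gamma>_le[of "s / 2"] by (cases v) auto
    moreover have "\<gamma> (s / 2) < \<gamma> s"
      using high(1) by (intro strict_mono_onD[OF \<gamma>_mono]) auto
    ultimately show ?thesis
      by simp
  next
    case (high s')
    with \<open>0 < s\<close> \<open>u = ereal (\<gamma> s)\<close> assms(1) have "\<not> s' < s"
      using strict_mono_onD[OF \<gamma>_mono, of s' s] by auto
    with high \<open>gamma_inv \<gamma> u = s\<close> show ?thesis
      by simp
  qed (use assms in auto)
qed (use assms in auto)

text \<open>Half of a Galois connection. In the low case \<open>u\<close> is below the infimum over
  positive arguments, which bounds \<open>\<gamma> r\<close> only for \<open>r > 0\<close>, since
  \<open>\<gamma> 0\<close> may be smaller.\<close>

lemma le_\<gamma>_gamma_inv: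
  assumes "gamma_inv \<gamma> (ereal u) \<le> r" "0 < r"
  shows "u \<le> \<gamma> r"
proof (cases "ereal u" rule: gamma_inv_cases)
  case low
  thus ?thesis
    using INF_\<gamma>_le[OF assms(2)] by simp
next
  case (high s)
  thus ?thesis
    using assms \<gamma>_le[of s r] by simp
qed auto

section \<open>Monotonicity and measurability of \<open>Phi_of\<close> and
  \<open>Psi_of\<close>\<close>

lemma Phi_of_nonneg: "0 \<le> Phi_of \<phi> x"
  by (simp add: Phi_of_eq \<phi>_nonneg)

lemma Phi_of_mono: "0 \<le> x \<Longrightarrow> x \<le> y \<Longrightarrow> Phi_of \<phi> x \<le> Phi_of \<phi> y"
  by (auto simp: Phi_of_eq \<phi>_nonneg intro!: \<phi>_le)

lemma Psi_of_nonneg: "0 \<le> Psi_of \<phi> \<gamma> x"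
  by (simp add: Psi_of_def \<phi>_nonneg)

lemma Psi_of_mono: "0 \<le> x \<Longrightarrow> x \<le> y \<Longrightarrow> Psi_of \<phi> \<gamma> x \<le> Psi_of \<phi> \<gamma> y"
  by (auto simp: Psi_of_def log_ext_def intro!: \<phi>_le gamma_inv_mono)

lemma measurable_Phi_of [measurable (raw)]:
  assumes [measurable]: "F \<in> borel_measurable M"
  shows "(\<lambda>\<zeta>. Phi_of \<phi> (cmod (F \<zeta>))) \<in> borel_measurable M"
proof -
  \<comment> \<open>Monotonicity is known for nonnegative arguments. Truncation at 0 makes it
    global, hence the function Borel, and changes nothing at a modulus.\<close>
  have "mono (\<lambda>x. Phi_of \<phi> (max 0 x))"
    by (intro monoI Phi_of_mono) auto
  hence "(\<lambda>x. Phi_of \<phi> (max 0 x)) \<in> borel_measurable borel"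
    by (rule borel_measurable_mono)
  moreover have "(\<lambda>\<zeta>. cmod (F \<zeta>)) \<in> borel_measurable M"
    by measurable
  ultimately have "(\<lambda>\<zeta>. Phi_of \<phi> (max 0 (cmod (F \<zeta>)))) \<in> borel_measurable M"
    by (rule measurable_compose[rotated])
  thus ?thesis
    by simp
qed

lemma measurable_Psi_of [measurable (raw)]:
  assumes [measurable]: "F \<in> borel_measurable M"
  shows "(\<lambda>\<zeta>. Psi_of \<phi> \<gamma> (cmod (F \<zeta>))) \<in> borel_measurable M"
proof -
  have "mono (\<lambda>x. Psi_of \<phi> \<gamma> (max 0 x))"
    by (intro monoI Psi_of_mono) auto
  hence "(\<lambda>x. Psi_of \<phi> \<gamma> (max 0 x)) \<in> borel_measurable borel"
    by (rule borel_measurable_mono)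
  moreover have "(\<lambda>\<zeta>. cmod (F \<zeta>)) \<in> borel_measurable M"
    by measurable
  ultimately have "(\<lambda>\<zeta>. Psi_of \<phi> \<gamma> (max 0 (cmod (F \<zeta>)))) \<in> borel_measurable M"
    by (rule measurable_compose[rotated])
  thus ?thesis
    by simp
qed

section \<open>The pointwise product inequality\<close>

lemma Phi_of_mult_le:
  obtains c K where "0 \<le> c" "0 \<le> K"
    "\<And>x y. 0 \<le> x \<Longrightarrow> 0 \<le> y \<Longrightarrow> Phi_of \<phi> (x * y) \<le> c * (Phi_of \<phi> x + Psi_of \<phi> \<gamma> y + K)"
proof -
  obtain c t0 where c: "c > 1" and t0: "t0 \<ge> 0"
      and D: "\<And>t. t \<ge> t0 \<Longrightarrow> \<phi> (t + \<gamma> t) / \<phi> t \<le> c"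
    using admissible unfolding tilde_Delta_admissible_def by blast
  \<comment> \<open>Adding 1 makes \<open>r\<close> strictly positive, as
    \<open>le_\<gamma>_gamma_inv\<close> requires, even when \<open>t0 = 0\<close>.\<close>
  define T where "T = t0 + 1"
  have le: "\<phi> (t + u) \<le> c * (\<phi> t + \<phi> (gamma_inv \<gamma> (ereal u)) + \<phi> T)" for t u
  proof -
    define s where "s = gamma_inv \<gamma> (ereal u)"
    define r where "r = max T (max t s)"
    have r: "t0 \<le> r" "0 < r" "t \<le> r" "s \<le> r"
      using t0 by (auto simp: r_def T_def)
    have "u \<le> \<gamma> r"
      using r by (intro le_\<gamma>_gamma_inv) (auto simp: s_def)
    \<comment> \<open>Needed to clear the denominator: a quotient by 0 equals 0 and would carry no
      information.\<close>
    have pos: "0 < \<phi> r"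
      using strict_monoD[OF \<phi>_mono, of "r - 1" r] \<phi>_nonneg[of "r - 1"] by simp
    have "\<phi> (t + u) \<le> \<phi> (r + \<gamma> r)"
      using r \<open>u \<le> \<gamma> r\<close> by (intro \<phi>_le) simp
    also have "\<dots> \<le> c * \<phi> r"
      using D[OF r(1)] pos by (simp add: pos_divide_le_eq)
    \<comment> \<open>\<open>r\<close> is one of \<open>t\<close>, \<open>s\<close>,
      \<open>T\<close>, and the other two summands are nonnegative.\<close>
    also have "\<phi> r \<le> \<phi> t + \<phi> s + \<phi> T"
      using \<phi>_nonneg[of t] \<phi>_nonneg[of s] \<phi>_nonneg[of T] by (auto simp: r_def max_def)
    finally show ?thesis
      using c by (simp add: s_def)
  qed
  have "Phi_of \<phi> (x * y) \<le> c * (Phi_of \<phi> x + Psi_of \<phi> \<gamma> y + \<phi> T)" if "0 \<le> x" "0 \<le> y" for x y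
  proof (cases "x = 0 \<or> y = 0")
    case True
    thus ?thesis
      using c Phi_of_nonneg[of x] Psi_of_nonneg[of y] \<phi>_nonneg[of T] by (auto simp: Phi_of_eq)
  next
    case False
    thus ?thesis
      using that le[of "ln x" "ln y"] by (simp add: Phi_of_eq Psi_of_def log_ext_def ln_mult)
  qed
  thus ?thesis
    using that[of c "\<phi> T"] c \<phi>_nonneg[of T] by simp
qed

section \<open>Multipliers\<close>

lemma hardy_orlicz_mult:
  assumes g: "g \<in> hardy_orlicz (Psi_of \<phi> \<gamma>)" and f: "f \<in> hardy_orlicz (Phi_of \<phi>)"
  shows "(\<lambda>z. g z * f z) \<in> hardy_orlicz (Phi_of \<phi>)"
proof -
  obtain G where G: "g \<in> smirnov_class" "boundary_function g G"
      "(\<integral>\<^sup>+ \<zeta>. ennreal (Psi_of \<phi> \<gamma> (cmod (G \<zeta>))) \<partial>circle_measure) < \<infinity>"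
    using g unfolding hardy_orlicz_def by auto
  obtain F where F: "f \<in> smirnov_class" "boundary_function f F"
      "(\<integral>\<^sup>+ \<zeta>. ennreal (Phi_of \<phi> (cmod (F \<zeta>))) \<partial>circle_measure) < \<infinity>"
    using f unfolding hardy_orlicz_def by auto
  have [measurable]: "F \<in> borel_measurable circle_measure" "G \<in> borel_measurable circle_measure"
    using F(2) G(2) unfolding boundary_function_def by auto
  obtain c K where cK: "0 \<le> c" "0 \<le> K" "\<And>x y. 0 \<le> x \<Longrightarrow> 0 \<le> y \<Longrightarrow>
      Phi_of \<phi> (x * y) \<le> c * (Phi_of \<phi> x + Psi_of \<phi> \<gamma> y + K)"
    by (rule Phi_of_mult_le) blast
  have "Phi_of \<phi> (cmod (G \<zeta> * F \<zeta>))
      \<le> c * (Phi_of \<phi> (cmod (F \<zeta>)) + Psi_of \<phi> \<gamma> (cmod (G \<zeta>)) + K)" for \<zeta>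
    using cK(3)[of "cmod (F \<zeta>)" "cmod (G \<zeta>)"] by (simp add: norm_mult mult.commute)
  hence "(\<integral>\<^sup>+ \<zeta>. ennreal (Phi_of \<phi> (cmod (G \<zeta> * F \<zeta>))) \<partial>circle_measure) < \<infinity>"
    by (intro nn_integral_circle_measure_dominated[OF _ _ _ _ cK(1,2) _ F(3) G(3)])
      (auto simp: Phi_of_nonneg Psi_of_nonneg)
  thus ?thesis
    using smirnov_class_mult[OF G(1) F(1)] boundary_function_mult[OF G(2) F(2)]
    unfolding hardy_orlicz_def by blast
qed

text \<open>Makes constants multipliers of the class for \<open>Phi_of \<phi>\<close>, which
  supplies the zero function and the scalar multiples in the final algebra.\<close>

lemma hardy_orlicz_const: "(\<lambda>z. a) \<in> hardy_orlicz (Psi_of \<phi> \<gamma>)"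
proof -
  have "(\<integral>\<^sup>+ \<zeta>. ennreal (Psi_of \<phi> \<gamma> (cmod a)) \<partial>circle_measure) < \<infinity>"
    using finite_measure.emeasure_finite[OF finite_measure_circle_measure]
    by (simp add: ennreal_mult_less_top less_top[symmetric] ennreal_mult_eq_top_iff)
  thus ?thesis
    using smirnov_class_const boundary_function_const unfolding hardy_orlicz_def by blast
qed

lemma hardy_orlicz_add:
  assumes f: "f \<in> hardy_orlicz (Phi_of \<phi>)" and g: "g \<in> hardy_orlicz (Phi_of \<phi>)"
  shows "(\<lambda>z. f z + g z) \<in> hardy_orlicz (Phi_of \<phi>)"
proof -
  obtain F where F: "f \<in> smirnov_class" "boundary_function f F"
      "(\<integral>\<^sup>+ \<zeta>. ennreal (Phi_of \<phi> (cmod (F \<zeta>))) \<partial>circle_measure) < \<infinity>"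
    using f unfolding hardy_orlicz_def by auto
  obtain G where G: "g \<in> smirnov_class" "boundary_function g G"
      "(\<integral>\<^sup>+ \<zeta>. ennreal (Phi_of \<phi> (cmod (G \<zeta>))) \<partial>circle_measure) < \<infinity>"
    using g unfolding hardy_orlicz_def by auto
  have [measurable]: "F \<in> borel_measurable circle_measure" "G \<in> borel_measurable circle_measure"
    using F(2) G(2) unfolding boundary_function_def by auto
  obtain c K where cK: "0 \<le> c" "0 \<le> K" "\<And>x y. 0 \<le> x \<Longrightarrow> 0 \<le> y \<Longrightarrow>
      Phi_of \<phi> (x * y) \<le> c * (Phi_of \<phi> x + Psi_of \<phi> \<gamma> y + K)"
    by (rule Phi_of_mult_le) blast
  \<comment> \<open>The sum of two moduli is at most twice their maximum; applying the product
    inequality with second factor 2 turns this factor into the additive constant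
    \<open>Psi_of \<phi> \<gamma> 2\<close>.\<close>
  define K' where "K' = Psi_of \<phi> \<gamma> 2 + K"
  have K': "0 \<le> K'"
    using cK(2) Psi_of_nonneg by (simp add: K'_def)
  have "Phi_of \<phi> (cmod (F \<zeta> + G \<zeta>))
      \<le> c * (Phi_of \<phi> (cmod (F \<zeta>)) + Phi_of \<phi> (cmod (G \<zeta>)) + K')" for \<zeta>
  proof -
    define m where "m = max (cmod (F \<zeta>)) (cmod (G \<zeta>))"
    have m: "0 \<le> m"
      by (simp add: m_def le_max_iff_disj)
    have "cmod (F \<zeta> + G \<zeta>) \<le> m * 2"
      using norm_triangle_ineq[of "F \<zeta>" "G \<zeta>"] by (auto simp: m_def)
    hence "Phi_of \<phi> (cmod (F \<zeta> + G \<zeta>)) \<le> Phi_of \<phi> (m * 2)"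
      by (intro Phi_of_mono) auto
    also have "\<dots> \<le> c * (Phi_of \<phi> m + K')"
      using cK(3)[OF m, of 2] by (simp add: K'_def add_ac)
    also have "Phi_of \<phi> m \<le> Phi_of \<phi> (cmod (F \<zeta>)) + Phi_of \<phi> (cmod (G \<zeta>))"
      using Phi_of_nonneg by (auto simp: m_def max_def)
    finally show ?thesis
      using cK(1) by (simp add: mult_left_mono)
  qed
  hence "(\<integral>\<^sup>+ \<zeta>. ennreal (Phi_of \<phi> (cmod (F \<zeta> + G \<zeta>))) \<partial>circle_measure) < \<infinity>"
    by (intro nn_integral_circle_measure_dominated[OF _ _ _ _ cK(1) K' _ F(3) G(3)])
      (auto simp: Phi_of_nonneg)
  thus ?thesis
    using smirnov_class_add[OF F(1) G(1)] boundary_function_add[OF F(2) G(2)]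
    unfolding hardy_orlicz_def by blast
qed

lemma hardy_orlicz_subset_Mult: "hardy_orlicz (Psi_of \<phi> \<gamma>) \<subseteq> Mult (hardy_orlicz (Phi_of \<phi>))"
  using smirnov_class_subset_Hol hardy_orlicz_mult unfolding Mult_def hardy_orlicz_def[of "Psi_of \<phi> \<gamma>"]
  by blast

end

section \<open>Multipliers as an algebra\<close>

lemma Mult_mult:
  assumes "g \<in> Mult X" "h \<in> Mult X"
  shows "(\<lambda>z. g z * h z) \<in> Mult X"
  using assms unfolding Mult_def Hol_def by (auto intro: holomorphic_intros simp: mult.assoc)

text \<open>By distributivity the sum acts on \<open>f\<close> as \<open>g f + h f\<close>, so
  closure of \<open>X\<close> under addition is what is needed.\<close>

lemma Mult_add:
  assumes "\<And>f g. f \<in> X \<Longrightarrow> g \<in> X \<Longrightarrow> (\<lambda>z. f z + g z) \<in> X" and "g \<in> Mult X" "h \<in> Mult X"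
  shows "(\<lambda>z. g z + h z) \<in> Mult X"
  using assms unfolding Mult_def Hol_def by (auto intro: holomorphic_intros simp: distrib_right)

theorem theorem3p1:
  fixes \<phi> \<gamma> :: "real \<Rightarrow> real"
  assumes "strongly_convex \<phi>"
    and "tilde_Delta \<phi>"
    and "tilde_Delta_admissible \<phi> \<gamma>"
  shows "Alg (hardy_orlicz (Psi_of \<phi> \<gamma>)) \<subseteq> Mult (hardy_orlicz (Phi_of \<phi>))"
proof -
  interpret admissible \<phi> \<gamma>
    using assms(2,3) by unfold_locales (auto simp: tilde_Delta_def)
  have const: "(\<lambda>z. a) \<in> Mult (hardy_orlicz (Phi_of \<phi>))" for a
    using hardy_orlicz_const hardy_orlicz_subset_Mult by blast
  \<comment> \<open>Zero is a constant multiplier, and a scalar multiple is a product with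
    one.\<close>
  have "function_algebra (Mult (hardy_orlicz (Phi_of \<phi>)))"
    unfolding function_algebra_def
    by (intro conjI ballI allI const Mult_mult[OF const] Mult_mult Mult_add hardy_orlicz_add)
  \<comment> \<open>\<open>Alg\<close> is the least function algebra containing its argument, so it
    lies in every algebra that contains the generators.\<close>
  with hardy_orlicz_subset_Mult show ?thesis
    unfolding Alg_def by (intro hull_minimal)
qed

end
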